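(* Let $K$ be a field of characteristic different from $2$ and $3$, let $a,d\in K$ be distinct and non-zero, and let $E: ax^2+y^2=1+dx^2y^2$ be the corresponding twisted Edwards curve with function field $K(E)$. Then any function $g\in K(E)$ can be written uniquely as $$g(x,y)=p(y)+x\,q(y)$$ where $p(y),q(y)$ are rational functions in $y$ (with coefficients in $K$).
   Context: The function field $K(E)$ is the field of fractions of the affine coordinate ring $K[x,y]/(ax^2+y^2-1-dx^2y^2)$. *)

theory Defs
  imports "HOL-Algebra.Algebraic_Closure_Type"
begin

section \<open>The field of fractions of an integral domain\<close>

definition frac_class :: "('a, 'm) ring_scheme \<Rightarrow> 'a \<Rightarrow> 'a \<Rightarrow> ('a \<times> 'a) set" where
  "frac_class R a b = {(a', b'). a' \<in> carrier R \<and> b' \<in> carrier R - {\<zero>\<^bsub>R\<^esub>} \<and>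
                           a \<otimes>\<^bsub>R\<^esub> b' = a' \<otimes>\<^bsub>R\<^esub> b}"

text \<open>
  For an integral domain, the unions below are taken over families of equal classes (lemmas
  \<open>mult_frac_class\<close> and \<open>add_frac_class\<close>), and the result is a field (lemma \<open>field_fraction_field\<close>).
\<close>

definition fraction_field :: "('a, 'm) ring_scheme \<Rightarrow> ('a \<times> 'a) set ring" where
  "fraction_field R =
    \<lparr> carrier = {frac_class R a b | a b. a \<in> carrier R \<and> b \<in> carrier R - {\<zero>\<^bsub>R\<^esub>}},
      monoid.mult = (\<lambda>u v. \<Union>(a, b)\<in>u. \<Union>(a', b')\<in>v. frac_class R (a \<otimes>\<^bsub>R\<^esub> a') (b \<otimes>\<^bsub>R\<^esub> b')),
      one = frac_class R \<one>\<^bsub>R\<^esub> \<one>\<^bsub>R\<^esub>,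
      ring.zero = frac_class R \<zero>\<^bsub>R\<^esub> \<one>\<^bsub>R\<^esub>,
      add = (\<lambda>u v. \<Union>(a, b)\<in>u. \<Union>(a', b')\<in>v.
               frac_class R (a \<otimes>\<^bsub>R\<^esub> b' \<oplus>\<^bsub>R\<^esub> a' \<otimes>\<^bsub>R\<^esub> b) (b \<otimes>\<^bsub>R\<^esub> b')) \<rparr>"

lemma UN_const:
  assumes "p \<in> u" "q \<in> v"
      and "\<And>a b a' b'. (a, b) \<in> u \<Longrightarrow> (a', b') \<in> v \<Longrightarrow> f a b a' b' = c"
  shows "(\<Union>(a, b)\<in>u. \<Union>(a', b')\<in>v. f a b a' b') = c"
proof -
  have *: "(\<Union>(a', b')\<in>v. f a b a' b') = c" if "(a, b) \<in> u" for a b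
    using assms(2) assms(3)[OF that] by (auto split: prod.splits)
  then have "(\<Union>(a, b)\<in>u. \<Union>(a', b')\<in>v. f a b a' b') = (\<Union>x\<in>u. c)"
    by (intro SUP_cong refl) (clarify, rule *)
  then show ?thesis using assms(1) by auto
qed

context domain
begin

lemma frac_class_self:
  assumes "a \<in> carrier R" "b \<in> carrier R - {\<zero>}"
  shows "(a, b) \<in> frac_class R a b"
  using assms by (auto simp: frac_class_def)

lemma frac_class_cross:
  assumes "a \<in> carrier R" "b \<in> carrier R - {\<zero>}"
      and "a' \<in> carrier R" "b' \<in> carrier R - {\<zero>}"
      and eq: "a \<otimes> b' = a' \<otimes> b"
  shows "frac_class R a b \<subseteq> frac_class R a' b'"
proof
  fix z assume "z \<in> frac_class R a b"
  then obtain x y where z: "z = (x, y)" "x \<in> carrier R" "y \<in> carrier R - {\<zero>}" "a \<otimes> y = x \<otimes> b"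
    by (auto simp: frac_class_def)
  note C = assms(1-4) z(2,3)
  have "b \<otimes> (a' \<otimes> y) = (a' \<otimes> b) \<otimes> y" using C by (simp add: m_ac)
  also have "\<dots> = (a \<otimes> b') \<otimes> y" by (simp only: eq)
  also have "\<dots> = b' \<otimes> (a \<otimes> y)" using C by (simp add: m_ac)
  also have "\<dots> = b' \<otimes> (x \<otimes> b)" by (simp only: z(4))
  also have "\<dots> = b \<otimes> (x \<otimes> b')" using C by (simp add: m_ac)
  finally have "a' \<otimes> y = x \<otimes> b'"
    using C by (subst (asm) m_lcancel) auto
  then show "z \<in> frac_class R a' b'" using z by (auto simp: frac_class_def)
qed

lemma frac_class_eq_iff:
  assumes "a \<in> carrier R" "b \<in> carrier R - {\<zero>}"
      and "a' \<in> carrier R" "b' \<in> carrier R - {\<zero>}"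
  shows "frac_class R a b = frac_class R a' b' \<longleftrightarrow> a \<otimes> b' = a' \<otimes> b"
proof
  assume "frac_class R a b = frac_class R a' b'"
  then have "(a', b') \<in> frac_class R a b" using frac_class_self assms by simp
  then show "a \<otimes> b' = a' \<otimes> b" by (simp add: frac_class_def)
next
  assume "a \<otimes> b' = a' \<otimes> b"
  then show "frac_class R a b = frac_class R a' b'"
    using frac_class_cross[OF assms] frac_class_cross[OF assms(3,4,1,2)] by force
qed

lemma frac_class_memD:
  assumes "(x, y) \<in> frac_class R a b"
  shows "x \<in> carrier R" "y \<in> carrier R" "y \<noteq> \<zero>" "a \<otimes> y = x \<otimes> b"
  using assms by (auto simp: frac_class_def)

lemma mult_frac_class:
  assumes "a \<in> carrier R" "b \<in> carrier R - {\<zero>}"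
      and "a' \<in> carrier R" "b' \<in> carrier R - {\<zero>}"
  shows "frac_class R a b \<otimes>\<^bsub>fraction_field R\<^esub> frac_class R a' b' = frac_class R (a \<otimes> a') (b \<otimes> b')"
proof -
  have "frac_class R (x \<otimes> x') (y \<otimes> y') = frac_class R (a \<otimes> a') (b \<otimes> b')"
    if "(x, y) \<in> frac_class R a b" "(x', y') \<in> frac_class R a' b'" for x y x' y'
  proof (subst frac_class_eq_iff)
    note D = frac_class_memD[OF that(1)] frac_class_memD[OF that(2)]
    have "x \<otimes> x' \<otimes> (b \<otimes> b') = (x \<otimes> b) \<otimes> (x' \<otimes> b')"
      using assms D(1-3,5-7) by (simp add: m_ac)
    also have "\<dots> = (a \<otimes> y) \<otimes> (a' \<otimes> y')" using D by simp
    also have "\<dots> = a \<otimes> a' \<otimes> (y \<otimes> y')"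
      using assms D(1-3,5-7) by (simp add: m_ac)
    finally show "x \<otimes> x' \<otimes> (b \<otimes> b') = a \<otimes> a' \<otimes> (y \<otimes> y')" .
  qed (use assms frac_class_memD[OF that(1)] frac_class_memD[OF that(2)] in \<open>auto dest: integral\<close>)
  then show ?thesis
    unfolding fraction_field_def ring_record_simps monoid.simps
    by (intro UN_const[OF frac_class_self[OF assms(1,2)] frac_class_self[OF assms(3,4)]])
qed

lemma add_frac_class:
  assumes "a \<in> carrier R" "b \<in> carrier R - {\<zero>}"
      and "a' \<in> carrier R" "b' \<in> carrier R - {\<zero>}"
  shows "frac_class R a b \<oplus>\<^bsub>fraction_field R\<^esub> frac_class R a' b' = frac_class R (a \<otimes> b' \<oplus> a' \<otimes> b) (b \<otimes> b')"
proof -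
  have "frac_class R (x \<otimes> y' \<oplus> x' \<otimes> y) (y \<otimes> y') = frac_class R (a \<otimes> b' \<oplus> a' \<otimes> b) (b \<otimes> b')"
    if "(x, y) \<in> frac_class R a b" "(x', y') \<in> frac_class R a' b'" for x y x' y'
  proof (subst frac_class_eq_iff)
    note D = frac_class_memD[OF that(1)] frac_class_memD[OF that(2)]
    have "(x \<otimes> y' \<oplus> x' \<otimes> y) \<otimes> (b \<otimes> b') = (x \<otimes> b) \<otimes> (y' \<otimes> b') \<oplus> (x' \<otimes> b') \<otimes> (y \<otimes> b)"
      using assms D(1-3,5-7) by (simp add: l_distr r_distr m_ac)
    also have "\<dots> = (a \<otimes> y) \<otimes> (y' \<otimes> b') \<oplus> (a' \<otimes> y') \<otimes> (y \<otimes> b)" using D by simp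
    also have "\<dots> = (a \<otimes> b' \<oplus> a' \<otimes> b) \<otimes> (y \<otimes> y')"
      using assms D(1-3,5-7) by (simp add: l_distr r_distr m_ac)
    finally show "(x \<otimes> y' \<oplus> x' \<otimes> y) \<otimes> (b \<otimes> b') = (a \<otimes> b' \<oplus> a' \<otimes> b) \<otimes> (y \<otimes> y')" .
  qed (use assms frac_class_memD[OF that(1)] frac_class_memD[OF that(2)] in \<open>auto dest: integral\<close>)
  then show ?thesis
    unfolding fraction_field_def ring_record_simps monoid.simps
    by (intro UN_const[OF frac_class_self[OF assms(1,2)] frac_class_self[OF assms(3,4)]])
qed

lemma field_fraction_field: "field (fraction_field R)"
proof -
  let ?F = "fraction_field R"
  have carr: "carrier ?F = {frac_class R a b | a b. a \<in> carrier R \<and> b \<in> carrier R - {\<zero>}}"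
    and one: "\<one>\<^bsub>?F\<^esub> = frac_class R \<one> \<one>" and zero: "\<zero>\<^bsub>?F\<^esub> = frac_class R \<zero> \<one>"
    by (simp_all add: fraction_field_def)
  have clo: "frac_class R a b \<in> carrier ?F" if "a \<in> carrier R" "b \<in> carrier R" "b \<noteq> \<zero>" for a b
    using that by (auto simp: carr)
  have E: thesis if "u \<in> carrier ?F"
    "\<And>a b. u = frac_class R a b \<Longrightarrow> a \<in> carrier R \<Longrightarrow> b \<in> carrier R \<Longrightarrow> b \<noteq> \<zero> \<Longrightarrow> thesis" for u thesis
    using that by (auto simp: carr)
  note rules = clo one zero mult_frac_class add_frac_class frac_class_eq_iff integral_iff
  show ?thesis
  proof (rule cring.cring_fieldI2)
    show "cring ?F"
    proof (rule cringI)
      show "abelian_group ?F"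
      proof (rule abelian_groupI)
        fix u v assume "u \<in> carrier ?F" "v \<in> carrier ?F"
        then show "u \<oplus>\<^bsub>?F\<^esub> v \<in> carrier ?F" "u \<oplus>\<^bsub>?F\<^esub> v = v \<oplus>\<^bsub>?F\<^esub> u"
          by (auto simp: rules a_comm m_comm elim!: E)
      next
        fix u v w assume "u \<in> carrier ?F" "v \<in> carrier ?F" "w \<in> carrier ?F"
        then show "u \<oplus>\<^bsub>?F\<^esub> v \<oplus>\<^bsub>?F\<^esub> w = u \<oplus>\<^bsub>?F\<^esub> (v \<oplus>\<^bsub>?F\<^esub> w)"
          by (auto simp: rules l_distr r_distr m_ac a_ac elim!: E)
      next
        fix u assume "u \<in> carrier ?F"
        then obtain x y where u: "u = frac_class R x y" "x \<in> carrier R" "y \<in> carrier R - {\<zero>}"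
          by (auto simp: carr)
        then show "\<zero>\<^bsub>?F\<^esub> \<oplus>\<^bsub>?F\<^esub> u = u"
          by (auto simp: rules elim!: E)
        have "frac_class R (\<ominus> x) y \<in> carrier ?F"
          using u by (auto simp: carr)
        moreover have "frac_class R (\<ominus> x) y \<oplus>\<^bsub>?F\<^esub> u = \<zero>\<^bsub>?F\<^esub>"
          using u by (auto simp: rules l_minus l_neg elim!: E)
        ultimately show "\<exists>v\<in>carrier ?F. v \<oplus>\<^bsub>?F\<^esub> u = \<zero>\<^bsub>?F\<^esub>" by blast
      qed (auto simp: rules elim!: E)
      show "comm_monoid ?F"
      proof (rule comm_monoidI)
        fix u v assume "u \<in> carrier ?F" "v \<in> carrier ?F"
        then show "u \<otimes>\<^bsub>?F\<^esub> v \<in> carrier ?F" "u \<otimes>\<^bsub>?F\<^esub> v = v \<otimes>\<^bsub>?F\<^esub> u"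
          by (auto simp: rules m_comm elim!: E)
      next
        fix u v w assume "u \<in> carrier ?F" "v \<in> carrier ?F" "w \<in> carrier ?F"
        then show "u \<otimes>\<^bsub>?F\<^esub> v \<otimes>\<^bsub>?F\<^esub> w = u \<otimes>\<^bsub>?F\<^esub> (v \<otimes>\<^bsub>?F\<^esub> w)"
          by (auto simp: rules m_ac elim!: E)
      qed (auto simp: rules elim!: E)
    next
      fix u v w assume "u \<in> carrier ?F" "v \<in> carrier ?F" "w \<in> carrier ?F"
      then show "(u \<oplus>\<^bsub>?F\<^esub> v) \<otimes>\<^bsub>?F\<^esub> w = u \<otimes>\<^bsub>?F\<^esub> w \<oplus>\<^bsub>?F\<^esub> v \<otimes>\<^bsub>?F\<^esub> w"
        by (elim E) (simp add: rules l_distr r_distr m_ac)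
    qed
  next
    show "\<zero>\<^bsub>?F\<^esub> \<noteq> \<one>\<^bsub>?F\<^esub>" by (simp add: rules)
  next
    fix u assume u: "u \<in> carrier ?F" "u \<noteq> \<zero>\<^bsub>?F\<^esub>"
    then obtain x y where xy: "u = frac_class R x y" "x \<in> carrier R" "y \<in> carrier R - {\<zero>}"
      by (auto simp: carr)
    with u have "x \<noteq> \<zero>" by (auto simp: rules elim!: E)
    with xy have "frac_class R y x \<in> carrier ?F" "u \<otimes>\<^bsub>?F\<^esub> frac_class R y x = \<one>\<^bsub>?F\<^esub>"
      by (auto simp: rules m_comm elim!: E)
    then show "\<exists>v\<in>carrier ?F. u \<otimes>\<^bsub>?F\<^esub> v = \<one>\<^bsub>?F\<^esub>" by blast
  qed
qed

end


section \<open>The function field of a twisted Edwards curve\<close>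

text \<open>
  The polynomial ring \<open>K[x, y]\<close> is represented as \<open>K[y][x]\<close>: the type \<open>'k poly poly\<close> consists of
  the polynomials in the outer variable \<open>x\<close> whose coefficients are polynomials in \<open>y\<close>.
\<close>

definition poly_x :: "'k::field poly poly" where
  "poly_x = [:0, 1:]"

definition poly_y :: "'k::field poly poly" where
  "poly_y = [:[:0, 1:]:]"

definition const_xy :: "'k::field \<Rightarrow> 'k poly poly" where
  "const_xy c = [:[:c:]:]"

definition edwards_poly :: "'k::field \<Rightarrow> 'k \<Rightarrow> 'k poly poly" where
  "edwards_poly a d =
     const_xy a * poly_x ^ 2 + poly_y ^ 2 - 1 - const_xy d * poly_x ^ 2 * poly_y ^ 2"

definition edwards_ideal :: "'k::field \<Rightarrow> 'k \<Rightarrow> 'k poly poly set" where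
  "edwards_ideal a d = PIdl\<^bsub>ring_of_type_algebra\<^esub> (edwards_poly a d)"

definition coord_ring :: "'k::field \<Rightarrow> 'k \<Rightarrow> 'k poly poly set ring" where
  "coord_ring a d = ring_of_type_algebra Quot edwards_ideal a d"

definition coord_class :: "'k::field \<Rightarrow> 'k \<Rightarrow> 'k poly poly \<Rightarrow> 'k poly poly set" where
  "coord_class a d f = edwards_ideal a d +>\<^bsub>ring_of_type_algebra\<^esub> f"

definition function_field ::
    "'k::field \<Rightarrow> 'k \<Rightarrow> ('k poly poly set \<times> 'k poly poly set) set ring" where
  "function_field a d = fraction_field (coord_ring a d)"

definition fun_x :: "'k::field \<Rightarrow> 'k \<Rightarrow> ('k poly poly set \<times> 'k poly poly set) set" where
  "fun_x a d = frac_class (coord_ring a d) (coord_class a d poly_x) (coord_class a d 1)"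

text \<open>
  Rational functions in one variable are the elements of \<open>'k poly fract\<close>.  The value at the
  function \<open>y\<close> of \<open>r = n / m\<close> is the fraction \<open>n(y) / m(y)\<close>, where \<open>[:n:]\<close> is
  \<open>n(y)\<close> as an element of \<open>K[y][x]\<close>.  The union is over all ways of writing \<open>r\<close> as a quotient of
  two polynomials; for distinct non-zero \<open>a\<close>, \<open>d\<close> in characteristic other than 2 they all give the
  same class, since the coordinate ring is then a domain in which \<open>m(y)\<close> is non-zero for \<open>m \<noteq> 0\<close>.
\<close>

definition rat_y ::
    "'k::field \<Rightarrow> 'k \<Rightarrow> 'k poly fract \<Rightarrow> ('k poly poly set \<times> 'k poly poly set) set" where
  "rat_y a d r = (\<Union>(n, m)\<in>{(n, m). m \<noteq> 0 \<and> r = Fract n m}.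
     frac_class (coord_ring a d) (coord_class a d [:n:]) (coord_class a d [:m:]))"

end

theory Submission
  imports Defs
begin

text \<open>
  Write \<open>A = K[y]\<close>, \<open>u = a - d y\<^sup>2\<close> and \<open>v = y\<^sup>2 - 1\<close>.  As a polynomial in \<open>x\<close> over \<open>A\<close>, the
  curve equation is \<open>F = u x\<^sup>2 + v\<close>, so adjoining a root \<open>x\<close> of \<open>F\<close> to \<open>K(y)\<close> gives a quadratic
  extension with basis \<open>1, x\<close>, provided that \<open>F\<close> is irreducible.  The proof carries this out
  inside \<open>A[x]\<close>, so that it applies directly to fractions of residue classes modulo \<open>F\<close>.

  Two properties of \<open>u\<close> and \<open>v\<close> drive everything.  They generate the unit ideal, since
  \<open>u + d v = a - d\<close> is a non-zero constant; this is the primitivity of \<open>F\<close>, and it allows powers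
  of \<open>u\<close> to be cancelled modulo \<open>F\<close> (lemma \<open>quadratic_dvd_smult_cancel\<close>).  Moreover the norm form
  \<open>u \<alpha>\<^sup>2 + v \<beta>\<^sup>2\<close>, which is \<open>u (\<alpha> + \<beta> x) (\<alpha> - \<beta> x)\<close> modulo \<open>F\<close>, has no non-trivial zero over
  \<open>A\<close>: at the point \<open>y = 1\<close> the first term has even order of vanishing and the second one odd
  order (lemma \<open>edwards_anisotropic\<close>).  This says that \<open>-v/u\<close> is not a square in \<open>K(y)\<close>.

  Together with pseudo-division by \<open>F\<close>, which leaves remainders \<open>\<alpha> + \<beta> x\<close>, these properties
  show that \<open>F\<close> is prime (lemma \<open>quadratic_dvd_mult\<close>), so the coordinate ring is a domain, and that
  multiplication by a conjugate turns every denominator into an element of \<open>A\<close> (lemma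
  \<open>quadratic_mult_const\<close>).  Hence every function is \<open>(\<alpha> + \<beta> x) / m\<close> with \<open>m\<close> in \<open>A\<close>, which is the
  required form.  It is unique because cross-multiplying two such fractions gives a polynomial of
  degree at most 1 in \<open>x\<close>, and \<open>F\<close>, of degree 2, divides it only if it vanishes.
\<close>

section \<open>Quadratic polynomials without linear term\<close>

lemma quadratic_pseudo_division:
  fixes u v :: "'r::idom"
  assumes "u \<noteq> 0"
  shows "\<exists>k q \<alpha> \<beta>. smult (u ^ k) f = [:v, 0, u:] * q + [:\<alpha>, \<beta>:]"
proof -
  obtain q r where qr: "pseudo_divmod f [:v, 0, u:] = (q, r)" by fastforce
  have F: "[:v, 0, u:] \<noteq> 0" "degree [:v, 0, u:] = 2" "coeff [:v, 0, u:] 2 = u"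
    using assms by (simp_all add: numeral_2_eq_2)
  have "degree r < 2"
    using pseudo_divmod(2)[OF F(1) qr] F(2) by auto
  moreover obtain \<alpha> r' where r: "r = pCons \<alpha> r'" by (cases r)
  ultimately have "degree r' = 0"
    by (simp add: degree_pCons_eq_if split: if_splits)
  then obtain \<beta> where "r = [:\<alpha>, \<beta>:]"
    using r by (auto elim: degree_eq_zeroE)
  with pseudo_divmod(1)[OF F(1) qr] F(2,3) show ?thesis by metis
qed

lemma quadratic_dvd_linear_iff:
  fixes u v :: "'r::idom"
  assumes "u \<noteq> 0"
  shows "[:v, 0, u:] dvd [:\<alpha>, \<beta>:] \<longleftrightarrow> \<alpha> = 0 \<and> \<beta> = 0"
proof
  assume dvd: "[:v, 0, u:] dvd [:\<alpha>, \<beta>:]"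
  have "degree [:\<alpha>, \<beta>:] < degree [:v, 0, u:]"
    using assms by simp
  then have "[:\<alpha>, \<beta>:] = 0"
    using dvd dvd_imp_degree_le not_less by blast
  then show "\<alpha> = 0 \<and> \<beta> = 0" by simp
qed auto

text \<open>
  A form of Gauss's lemma in which comaximality of the coefficients replaces unique
  factorization.  If \<open>u g = F h\<close>, then \<open>u h\<close> and \<open>v h = F h - u x\<^sup>2 h\<close> are both divisible by
  \<open>u\<close>; since \<open>u\<close> and \<open>v\<close> generate the unit ideal, so is \<open>h\<close> itself, and \<open>u\<close> cancels.
\<close>

lemma quadratic_dvd_smult_cancel:
  fixes u v :: "'r::idom"
  assumes "u \<noteq> 0" and comax: "s * u + t * v = 1"
    and "[:v, 0, u:] dvd smult (u ^ k) f"
  shows "[:v, 0, u:] dvd f"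
  using assms(3)
proof (induction k)
  case (Suc k)
  let ?F = "[:v, 0, u:]" and ?g = "smult (u ^ k) f" and ?X = "[:0, 0, 1::'r:]"
  from Suc.prems obtain h where h: "smult u ?g = ?F * h" by auto
  have F: "?F = smult u ?X + [:v:]" by simp
  have vh: "smult v h = smult u (?g - ?X * h)"
    using h unfolding F by (simp add: algebra_simps smult_diff_right)
  have "h = smult (s * u + t * v) h" by (simp add: comax)
  also have "\<dots> = smult s (smult u h) + smult t (smult v h)"
    by (simp add: smult_add_left)
  also have "\<dots> = smult u (smult s h + smult t (?g - ?X * h))"
    unfolding vh by (simp add: smult_add_right mult.commute)
  finally obtain w where "h = smult u w" by blast
  with h have "smult u ?g = smult u (?F * w)" by simp
  with \<open>u \<noteq> 0\<close> have "?g = ?F * w" using smult_cancel by blast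
  then show ?case by (intro Suc.IH) (rule dvdI)
qed simp

text \<open>
  After pseudo-division the factors may be taken to be \<open>\<alpha> + \<beta> x\<close> and \<open>\<gamma> + \<delta> x\<close>.  Reducing \<open>u\<close> times
  their product modulo \<open>F\<close> to degree 1 gives two equations between the coefficients, and
  eliminating \<open>\<gamma>\<close> from them yields \<open>\<delta> (u \<alpha>\<^sup>2 + v \<beta>\<^sup>2) = 0\<close>.
\<close>

lemma quadratic_dvd_mult:
  fixes u v :: "'r::idom"
  assumes u: "u \<noteq> 0" and comax: "s * u + t * v = 1"
    and aniso: "\<And>\<alpha> \<beta>. u * \<alpha>\<^sup>2 + v * \<beta>\<^sup>2 = 0 \<Longrightarrow> \<beta> = 0"
    and dvd: "[:v, 0, u:] dvd f * g"
  shows "[:v, 0, u:] dvd f \<or> [:v, 0, u:] dvd g"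
proof -
  let ?F = "[:v, 0, u:]"
  obtain k q \<alpha> \<beta> where f: "smult (u ^ k) f = ?F * q + [:\<alpha>, \<beta>:]"
    using quadratic_pseudo_division[OF u] by blast
  obtain l r \<gamma> \<delta> where g: "smult (u ^ l) g = ?F * r + [:\<gamma>, \<delta>:]"
    using quadratic_pseudo_division[OF u] by blast
  have "[:\<alpha>, \<beta>:] * [:\<gamma>, \<delta>:]
      = smult (u ^ k) f * smult (u ^ l) g - ?F * (q * smult (u ^ l) g + r * [:\<alpha>, \<beta>:])"
    unfolding f g by (simp only: algebra_simps)
  moreover have "?F dvd smult (u ^ k) f * smult (u ^ l) g"
    using dvd by (simp add: dvd_smult)
  ultimately have "?F dvd [:\<alpha>, \<beta>:] * [:\<gamma>, \<delta>:]"
    by (simp only: dvd_diff dvd_triv_left)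
  \<comment> \<open>The subtracted multiple of \<open>F\<close> cancels the term of degree 2.\<close>
  then have "?F dvd smult u ([:\<alpha>, \<beta>:] * [:\<gamma>, \<delta>:]) - ?F * [:\<beta> * \<delta>:]"
    by (intro dvd_diff dvd_smult dvd_triv_left)
  also have "smult u ([:\<alpha>, \<beta>:] * [:\<gamma>, \<delta>:]) - ?F * [:\<beta> * \<delta>:]
      = [:u * \<alpha> * \<gamma> - v * \<beta> * \<delta>, u * (\<alpha> * \<delta> + \<beta> * \<gamma>):]"
    by (simp add: algebra_simps)
  finally have eqs: "u * \<alpha> * \<gamma> = v * \<beta> * \<delta>" "\<alpha> * \<delta> + \<beta> * \<gamma> = 0"
    unfolding quadratic_dvd_linear_iff[OF u] using u by auto
  have "\<delta> * (u * \<alpha>\<^sup>2 + v * \<beta>\<^sup>2) = u * \<alpha> * (\<alpha> * \<delta> + \<beta> * \<gamma>) - \<beta> * (u * \<alpha> * \<gamma> - v * \<beta> * \<delta>)"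
    by (simp add: algebra_simps power2_eq_square)
  then have "\<delta> = 0 \<or> \<beta> = 0" using eqs aniso by auto
  with eqs u have "(\<alpha> = 0 \<and> \<beta> = 0) \<or> (\<gamma> = 0 \<and> \<delta> = 0)" by auto
  then show ?thesis
  proof
    assume "\<alpha> = 0 \<and> \<beta> = 0"
    with f have "?F dvd smult (u ^ k) f" by (metis add.right_neutral dvd_triv_left pCons_0_0)
    then show ?thesis using quadratic_dvd_smult_cancel[OF u comax] by blast
  next
    assume "\<gamma> = 0 \<and> \<delta> = 0"
    with g have "?F dvd smult (u ^ l) g" by (metis add.right_neutral dvd_triv_left pCons_0_0)
    then show ?thesis using quadratic_dvd_smult_cancel[OF u comax] by blast
  qed
qed

text \<open>
  Rationalizing a denominator: if \<open>u\<^sup>k f\<close> reduces to \<open>\<alpha> + \<beta> x\<close>, the multiplier \<open>w\<close> is \<open>u\<^sup>k\<close> times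
  \<open>u\<close> times the conjugate \<open>\<alpha> - \<beta> x\<close>, which makes \<open>n\<close> the norm form at \<open>(\<alpha>, \<beta>)\<close>.
\<close>

lemma quadratic_mult_const:
  fixes u v :: "'r::idom"
  assumes u: "u \<noteq> 0" and comax: "s * u + t * v = 1"
    and aniso: "\<And>\<alpha> \<beta>. u * \<alpha>\<^sup>2 + v * \<beta>\<^sup>2 = 0 \<Longrightarrow> \<beta> = 0"
    and ndvd: "\<not> [:v, 0, u:] dvd f"
  shows "\<exists>w n. n \<noteq> 0 \<and> [:v, 0, u:] dvd w * f - [:n:]"
proof -
  let ?F = "[:v, 0, u:]"
  obtain k q \<alpha> \<beta> where f: "smult (u ^ k) f = ?F * q + [:\<alpha>, \<beta>:]"
    using quadratic_pseudo_division[OF u] by blast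
  let ?n = "u * \<alpha>\<^sup>2 + v * \<beta>\<^sup>2" and ?w = "smult (u ^ k) [:u * \<alpha>, - u * \<beta>:]"
  have "?n \<noteq> 0"
  proof
    assume n: "?n = 0"
    then have "\<beta> = 0" by (rule aniso)
    with n u have "\<alpha> = 0" by simp
    with f \<open>\<beta> = 0\<close> have "?F dvd smult (u ^ k) f"
      by (metis add.right_neutral dvd_triv_left pCons_0_0)
    then show False using quadratic_dvd_smult_cancel[OF u comax] ndvd by blast
  qed
  moreover have "?w * f - [:?n:] = ?F * (q * [:u * \<alpha>, - u * \<beta>:] + [:- (\<beta>\<^sup>2):])"
  proof -
    have "?w * f = smult (u ^ k) f * [:u * \<alpha>, - u * \<beta>:]" by (simp add: mult.commute)
    also have "\<dots> = ?F * (q * [:u * \<alpha>, - u * \<beta>:]) + [:\<alpha>, \<beta>:] * [:u * \<alpha>, - u * \<beta>:]"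
      unfolding f by (simp only: algebra_simps)
    also have "[:\<alpha>, \<beta>:] * [:u * \<alpha>, - u * \<beta>:] = ?F * [:- (\<beta>\<^sup>2):] + [:?n:]"
      by (simp add: algebra_simps power2_eq_square)
    finally show ?thesis by (simp only: distrib_left add.assoc[symmetric] add_diff_cancel_right')
  qed
  ultimately show ?thesis by (metis dvd_triv_left)
qed

section \<open>The Edwards polynomial\<close>

lemma edwards_poly_eq:
  "edwards_poly a d = [:[:-1, 0, 1:], 0, [:a, 0, -d:]:]"
  by (simp add: edwards_poly_def const_xy_def poly_x_def poly_y_def power2_eq_square
      one_pCons algebra_simps)

lemma edwards_comaximal:
  fixes a d :: "'k::field"
  assumes "a \<noteq> d"
  shows "[:inverse (a - d):] * [:a, 0, -d:] + [:d * inverse (a - d):] * [:-1, 0, 1:] = 1"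
proof -
  have "inverse (a - d) * a - d * inverse (a - d) = 1"
    using assms by (simp add: left_diff_distrib[symmetric] mult.commute)
  then show ?thesis by (simp add: one_pCons algebra_simps)
qed

lemma edwards_leading_coeff_nonzero:
  fixes a d :: "'k::field"
  assumes "a \<noteq> d"
  shows "[:a, 0, -d:] \<noteq> 0"
  using assms by auto

text \<open>
  At \<open>y = 1\<close> the coefficient \<open>a - d y\<^sup>2\<close> takes the value \<open>a - d \<noteq> 0\<close>, whereas
  \<open>y\<^sup>2 - 1 = (y - 1) (y + 1)\<close> has a simple zero, because \<open>1 + 1 \<noteq> 0\<close>.  For a non-trivial zero
  of the form, the orders at \<open>1\<close> of the two terms would be equal but of different parity.
\<close>

lemma edwards_anisotropic:
  fixes a d :: "'k::field"
  assumes "CHAR('k) \<noteq> 2" "a \<noteq> d"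
    and eq: "[:a, 0, -d:] * \<alpha>\<^sup>2 + [:-1, 0, 1:] * \<beta>\<^sup>2 = 0"
  shows "\<beta> = 0"
proof (rule ccontr)
  assume \<beta>: "\<beta> \<noteq> 0"
  have "(2 :: 'k) \<noteq> 0"
  proof
    assume "(2 :: 'k) = 0"
    then have "CHAR('k) dvd 2"
      using of_nat_eq_0_iff_char_dvd[where ?'a = 'k, of 2] by simp
    then show False
      using assms(1) CHAR_not_1[where ?'a = 'k] two_is_prime_nat prime_nat_iff by force
  qed
  have v: "[:-1, 0, 1:] = [:-1, 1::'k:] * [:1, 1:]" by simp
  have "order 1 [:1, 1::'k:] = 0"
    using \<open>2 \<noteq> 0\<close> by (intro order_0I) simp
  moreover have "order 1 [:-1, 1::'k:] = 1"
    using order_power_n_n[of "1::'k" 1] by simp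
  ultimately have "order 1 [:-1, 0, 1::'k:] = 1"
    unfolding v by (subst order_mult) auto
  moreover have "order 1 [:a, 0, -d:] = 0"
    using assms(2) by (intro order_0I) simp
  moreover have "[:a, 0, -d:] * \<alpha>\<^sup>2 = - ([:-1, 0, 1:] * \<beta>\<^sup>2)"
    using eq by (simp only: eq_neg_iff_add_eq_0)
  moreover have "\<alpha> \<noteq> 0"
    using eq \<beta>
    by (metis add_0 mult_eq_0_iff mult_zero_right one_neq_zero pCons_eq_0_iff power_not_zero
        zero_power2)
  ultimately have "order 1 (\<alpha>\<^sup>2) = Suc (order 1 (\<beta>\<^sup>2))"
    using \<beta> assms(2) order_mult[of "[:a, 0, -d:]" "\<alpha>\<^sup>2" 1] order_mult[of "[:-1, 0, 1:]" "\<beta>\<^sup>2" 1]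
    by (auto simp del: mult_pCons_left mult_pCons_right)
  moreover have "order 1 (\<alpha>\<^sup>2) = 2 * order 1 \<alpha>" "order 1 (\<beta>\<^sup>2) = 2 * order 1 \<beta>"
    using \<beta> \<open>\<alpha> \<noteq> 0\<close> by (simp_all add: power2_eq_square order_mult)
  ultimately show False by presburger
qed

section \<open>The coordinate ring\<close>

lemma ring_of_type_algebra_sel [simp]:
  "carrier ring_of_type_algebra = UNIV"
  "x \<otimes>\<^bsub>ring_of_type_algebra\<^esub> y = x * y"
  "x \<oplus>\<^bsub>ring_of_type_algebra\<^esub> y = x + y"
  "\<one>\<^bsub>ring_of_type_algebra\<^esub> = 1"
  "\<zero>\<^bsub>ring_of_type_algebra\<^esub> = 0"
  by (simp_all add: ring_of_type_algebra_def)

lemma mem_edwards_ideal: "f \<in> edwards_ideal a d \<longleftrightarrow> edwards_poly a d dvd f"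
  by (auto simp: edwards_ideal_def cgenideal_def mult.commute elim: dvdE)

context
  fixes a d :: "'k::field"
begin

interpretation P: cring "ring_of_type_algebra :: 'k poly poly ring"
  by (rule cring_from_type_algebra)

interpretation I: ideal "edwards_ideal a d" "ring_of_type_algebra :: 'k poly poly ring"
  unfolding edwards_ideal_def by (rule P.cgenideal_ideal) simp

lemma coord_class_in_carrier: "coord_class a d f \<in> carrier (coord_ring a d)"
  using P.a_rcosetsI[OF I.a_subset, of f] by (simp add: coord_class_def coord_ring_def FactRing_def)

lemma coord_ring_carrierE:
  assumes "c \<in> carrier (coord_ring a d)"
  obtains f where "c = coord_class a d f"
  using assms
  by (auto simp: coord_class_def coord_ring_def FactRing_def A_RCOSETS_def RCOSETS_def a_r_coset_def)

lemma coord_class_mult: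
  "coord_class a d f \<otimes>\<^bsub>coord_ring a d\<^esub> coord_class a d g = coord_class a d (f * g)"
  using ring_hom_mult[OF I.rcos_ring_hom, of f g] by (simp add: coord_class_def coord_ring_def)

lemma coord_class_add:
  "coord_class a d f \<oplus>\<^bsub>coord_ring a d\<^esub> coord_class a d g = coord_class a d (f + g)"
  using ring_hom_add[OF I.rcos_ring_hom, of f g] by (simp add: coord_class_def coord_ring_def)

lemma coord_class_eq_iff: "coord_class a d f = coord_class a d g \<longleftrightarrow> edwards_poly a d dvd f - g"
proof -
  have "f \<ominus>\<^bsub>ring_of_type_algebra\<^esub> g = f - g"
  proof -
    have "\<ominus>\<^bsub>ring_of_type_algebra\<^esub> g = - g"
      using P.minus_equality[of "- g" g] by simp
    then show ?thesis by (simp add: a_minus_def)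
  qed
  then show ?thesis
    using P.quotient_eq_iff_same_a_r_cos[OF I.is_ideal, of f g]
    by (simp add: coord_class_def mem_edwards_ideal)
qed

lemma coord_ring_zero: "\<zero>\<^bsub>coord_ring a d\<^esub> = coord_class a d 0"
  using I.a_rcos_const[of 0]
  by (simp add: coord_ring_def FactRing_def coord_class_def mem_edwards_ideal)

context
  assumes char: "CHAR('k) \<noteq> 2" and neq: "a \<noteq> d"
begin

lemma edwards_dvd_mult:
  assumes "edwards_poly a d dvd f * g"
  shows "edwards_poly a d dvd f \<or> edwards_poly a d dvd g"
  using assms unfolding edwards_poly_eq
  by (rule quadratic_dvd_mult[OF edwards_leading_coeff_nonzero[OF neq] edwards_comaximal[OF neq]
        edwards_anisotropic[OF char neq], rotated])

lemma edwards_mult_const: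
  assumes "\<not> edwards_poly a d dvd f"
  shows "\<exists>w n. n \<noteq> 0 \<and> edwards_poly a d dvd w * f - [:n:]"
  using assms unfolding edwards_poly_eq
  by (rule quadratic_mult_const[OF edwards_leading_coeff_nonzero[OF neq] edwards_comaximal[OF neq]
        edwards_anisotropic[OF char neq], rotated])

lemmas edwards_dvd_linear_iff =
  quadratic_dvd_linear_iff[OF edwards_leading_coeff_nonzero[OF neq],
    where v = "[:-1, 0, 1:]", folded edwards_poly_eq]

lemma edwards_not_dvd_const: "n \<noteq> 0 \<Longrightarrow> \<not> edwards_poly a d dvd [:n:]"
  using edwards_dvd_linear_iff[of n 0] by simp

lemma domain_coord_ring: "domain (coord_ring a d)"
proof -
  have "\<not> edwards_poly a d dvd 1"
    using edwards_not_dvd_const[of 1] by (simp add: one_pCons)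
  then have "primeideal (edwards_ideal a d) (ring_of_type_algebra :: 'k poly poly ring)"
    using edwards_dvd_mult
    by (intro primeidealI I.is_ideal P.is_cring) (auto simp: mem_edwards_ideal)
  then show ?thesis
    unfolding coord_ring_def by (rule primeideal.quotient_is_domain)
qed

interpretation C: domain "coord_ring a d"
  by (rule domain_coord_ring)

section \<open>Fractions with denominators in one variable\<close>

lemma coord_class_nonzero:
  "\<not> edwards_poly a d dvd f \<Longrightarrow> coord_class a d f \<in> carrier (coord_ring a d) - {\<zero>\<^bsub>coord_ring a d\<^esub>}"
  by (simp add: coord_class_in_carrier coord_ring_zero coord_class_eq_iff)

lemma frac_coord_class_eq_iff:
  assumes "\<not> edwards_poly a d dvd f'" "\<not> edwards_poly a d dvd g'"
  shows "frac_class (coord_ring a d) (coord_class a d f) (coord_class a d f')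
       = frac_class (coord_ring a d) (coord_class a d g) (coord_class a d g')
    \<longleftrightarrow> edwards_poly a d dvd f * g' - g * f'"
  using assms
  by (simp only: C.frac_class_eq_iff coord_class_in_carrier coord_class_nonzero
      coord_class_mult coord_class_eq_iff not_False_eq_True)

text \<open>
  The union that defines \<open>rat_y\<close> runs over all representations of the rational function; it
  collapses to one fraction because they all give the same class.
\<close>

lemma rat_y_Fract:
  assumes "m \<noteq> 0"
  shows "rat_y a d (Fract n m)
    = frac_class (coord_ring a d) (coord_class a d [:n:]) (coord_class a d [:m:])"
proof -
  have "frac_class (coord_ring a d) (coord_class a d [:n':]) (coord_class a d [:m':])
      = frac_class (coord_ring a d) (coord_class a d [:n:]) (coord_class a d [:m:])"
    if "m' \<noteq> 0" "Fract n m = Fract n' m'" for n' m'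
  proof -
    have "[:n':] * [:m:] - [:n:] * [:m':] = 0"
      using that assms by (simp add: eq_fract mult.commute)
    then show ?thesis
      using that assms by (simp only: frac_coord_class_eq_iff edwards_not_dvd_const dvd_0_right
          not_False_eq_True)
  qed
  then show ?thesis
    using assms unfolding rat_y_def by blast
qed

lemma rat_y_combination:
  assumes "m \<noteq> 0"
  shows "rat_y a d (Fract n m) \<oplus>\<^bsub>function_field a d\<^esub>
      (fun_x a d \<otimes>\<^bsub>function_field a d\<^esub> rat_y a d (Fract n' m))
    = frac_class (coord_ring a d) (coord_class a d [:n, n':]) (coord_class a d [:m:])"
proof -
  have m: "\<not> edwards_poly a d dvd [:m:]" "\<not> edwards_poly a d dvd [:m:] * [:m:]"
    using edwards_not_dvd_const[of m] edwards_dvd_mult[of "[:m:]" "[:m:]"] assms by blast+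
  have one: "\<not> edwards_poly a d dvd 1"
    using edwards_not_dvd_const[of 1] by (simp add: one_pCons)
  have "poly_x * [:n':] = [:0, n':]"
    by (simp add: poly_x_def)
  then have "fun_x a d \<otimes>\<^bsub>function_field a d\<^esub> rat_y a d (Fract n' m)
      = frac_class (coord_ring a d) (coord_class a d [:0, n':]) (coord_class a d [:m:])"
    unfolding function_field_def fun_x_def rat_y_Fract[OF assms]
    by (simp only: C.mult_frac_class coord_class_in_carrier coord_class_nonzero m one
        not_False_eq_True coord_class_mult mult_1)
  then have "rat_y a d (Fract n m) \<oplus>\<^bsub>function_field a d\<^esub>
      (fun_x a d \<otimes>\<^bsub>function_field a d\<^esub> rat_y a d (Fract n' m))
    = frac_class (coord_ring a d) (coord_class a d ([:n:] * [:m:] + [:0, n':] * [:m:]))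
        (coord_class a d ([:m:] * [:m:]))"
    unfolding function_field_def rat_y_Fract[OF assms]
    by (simp only: C.add_frac_class coord_class_in_carrier coord_class_nonzero m not_False_eq_True
        coord_class_mult coord_class_add)
  also have "\<dots> = frac_class (coord_ring a d) (coord_class a d [:n, n':]) (coord_class a d [:m:])"
  proof (subst frac_coord_class_eq_iff[OF m(2,1)])
    have "([:n:] * [:m:] + [:0, n':] * [:m:]) * [:m:] - [:n, n':] * ([:m:] * [:m:]) = 0"
      by (simp add: algebra_simps)
    then show "edwards_poly a d dvd
        ([:n:] * [:m:] + [:0, n':] * [:m:]) * [:m:] - [:n, n':] * ([:m:] * [:m:])"
      by (simp only: dvd_0_right)
  qed
  finally show ?thesis .
qed

text \<open>
  The fraction \<open>f1 / f2\<close> is first expanded by \<open>w\<close> to make its denominator the polynomial \<open>n\<close> in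
  \<open>y\<close>, and then by the power \<open>U\<close> of the leading coefficient that lets the new numerator \<open>w f1\<close> be
  reduced to degree 1 in \<open>x\<close>.
\<close>

lemma function_field_normal_form:
  assumes "g \<in> carrier (function_field a d)"
  shows "\<exists>n n' m. m \<noteq> 0 \<and>
    g = frac_class (coord_ring a d) (coord_class a d [:n, n':]) (coord_class a d [:m:])"
proof -
  obtain f1 f2 where f2: "\<not> edwards_poly a d dvd f2"
    and g: "g = frac_class (coord_ring a d) (coord_class a d f1) (coord_class a d f2)"
  proof -
    from assms obtain b c where *: "b \<in> carrier (coord_ring a d)" "c \<in> carrier (coord_ring a d)"
      "c \<noteq> \<zero>\<^bsub>coord_ring a d\<^esub>" "g = frac_class (coord_ring a d) b c"
      by (auto simp: function_field_def fraction_field_def)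
    obtain f1 f2 where "b = coord_class a d f1" "c = coord_class a d f2"
      using *(1,2) by (metis coord_ring_carrierE)
    with * that show thesis by (simp add: coord_ring_zero coord_class_eq_iff)
  qed
  obtain w n where n: "n \<noteq> 0" and w: "edwards_poly a d dvd w * f2 - [:n:]"
    using edwards_mult_const[OF f2] by blast
  obtain k q \<alpha> \<beta> where k:
    "smult ([:a, 0, -d:] ^ k) (w * f1) = edwards_poly a d * q + [:\<alpha>, \<beta>:]"
    using quadratic_pseudo_division[OF edwards_leading_coeff_nonzero[OF neq]]
    unfolding edwards_poly_eq by blast
  define U where "U = [:a, 0, -d:] ^ k"
  have "U \<noteq> 0"
    unfolding U_def using edwards_leading_coeff_nonzero[OF neq] by (rule power_not_zero)
  let ?m = "U * n"
  from n \<open>U \<noteq> 0\<close> have m: "?m \<noteq> 0" by simp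
  have *: "[:U:] * (w * f1) = edwards_poly a d * q + [:\<alpha>, \<beta>:]"
    using k by (simp add: U_def)
  have **: "[:?m:] = [:U:] * [:n:]" by simp
  have "f1 * [:?m:] - [:\<alpha>, \<beta>:] * f2
      = edwards_poly a d * q * f2 - [:U:] * f1 * (w * f2 - [:n:])"
  proof -
    have rem: "[:\<alpha>, \<beta>:] = [:U:] * (w * f1) - edwards_poly a d * q"
      by (simp only: * add_diff_cancel_left')
    show ?thesis unfolding ** rem by (simp only: algebra_simps)
  qed
  moreover have "edwards_poly a d dvd
      edwards_poly a d * q * f2 - [:U:] * f1 * (w * f2 - [:n:])"
    using w by (metis dvd_diff dvd_mult dvd_mult2 dvd_refl)
  ultimately have "edwards_poly a d dvd f1 * [:?m:] - [:\<alpha>, \<beta>:] * f2"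
    by (simp only:)
  then have "g = frac_class (coord_ring a d) (coord_class a d [:\<alpha>, \<beta>:]) (coord_class a d [:?m:])"
    unfolding g by (simp only: frac_coord_class_eq_iff f2 edwards_not_dvd_const m
      not_False_eq_True)
  with m show ?thesis by blast
qed

text \<open>
  The cross-multiplied difference has degree at most 1 in \<open>x\<close>, so being a multiple of the curve
  equation it is zero.
\<close>

lemma linear_frac_eq_imp:
  assumes "m \<noteq> 0" "k \<noteq> 0"
    and "frac_class (coord_ring a d) (coord_class a d [:n, n':]) (coord_class a d [:m:])
       = frac_class (coord_ring a d) (coord_class a d [:l, l':]) (coord_class a d [:k:])"
  shows "Fract n m = Fract l k \<and> Fract n' m = Fract l' k"
proof -
  have "[:n, n':] * [:k:] - [:l, l':] * [:m:] = [:n * k - l * m, n' * k - l' * m:]"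
    by (simp add: algebra_simps)
  moreover have "edwards_poly a d dvd [:n, n':] * [:k:] - [:l, l':] * [:m:]"
    using assms frac_coord_class_eq_iff edwards_not_dvd_const by blast
  ultimately have "n * k - l * m = 0 \<and> n' * k - l' * m = 0"
    by (simp only: edwards_dvd_linear_iff)
  with assms(1,2) show ?thesis by (simp add: eq_fract)
qed

end

end

lemma Fract_common_denominator:
  obtains n n' m where "m \<noteq> 0" "p = Fract n m" "q = Fract n' m"
proof -
  obtain k l where p: "p = Fract k l" "l \<noteq> 0" by (cases p)
  obtain k' l' where q: "q = Fract k' l'" "l' \<noteq> 0" by (cases q)
  show thesis
    by (rule that[of "l * l'" "k * l'" "k' * l"]) (use p q in \<open>simp_all add: eq_fract\<close>)
qed

theorem theorem4p1:
  fixes a d :: "'k::field"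
  assumes "CHAR('k) \<noteq> 2" and "CHAR('k) \<noteq> 3"
    and "a \<noteq> d" and "a \<noteq> 0" and "d \<noteq> 0"
    and "g \<in> carrier (function_field a d)"
  shows "\<exists>!pq :: 'k poly fract \<times> 'k poly fract. case pq of (p, q) \<Rightarrow>
    g = rat_y a d p \<oplus>\<^bsub>function_field a d\<^esub>
          (fun_x a d \<otimes>\<^bsub>function_field a d\<^esub> rat_y a d q)"
proof -
  note E = assms(1,3)
  obtain n n' m where m: "m \<noteq> 0"
    and g: "g = frac_class (coord_ring a d) (coord_class a d [:n, n':]) (coord_class a d [:m:])"
    using function_field_normal_form[OF E assms(6)] by blast
  show ?thesis
  proof (rule ex1I[of _ "(Fract n m, Fract n' m)"])
    show "case (Fract n m, Fract n' m) of (p, q) \<Rightarrow>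
        g = rat_y a d p \<oplus>\<^bsub>function_field a d\<^esub> (fun_x a d \<otimes>\<^bsub>function_field a d\<^esub> rat_y a d q)"
      using rat_y_combination[OF E m] g by simp
  next
    fix pq :: "'k poly fract \<times> 'k poly fract"
    assume *: "case pq of (p, q) \<Rightarrow>
        g = rat_y a d p \<oplus>\<^bsub>function_field a d\<^esub> (fun_x a d \<otimes>\<^bsub>function_field a d\<^esub> rat_y a d q)"
    obtain p q where pq: "pq = (p, q)" by (cases pq)
    obtain l l' k where k: "k \<noteq> 0" and pq': "p = Fract l k" "q = Fract l' k"
      by (rule Fract_common_denominator)
    have "g = frac_class (coord_ring a d) (coord_class a d [:l, l':]) (coord_class a d [:k:])"
      using * rat_y_combination[OF E k] unfolding pq pq' by simp
    with g linear_frac_eq_imp[OF E k m] show "pq = (Fract n m, Fract n' m)"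
      unfolding pq pq' by simp
  qed
qed

end
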